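(* Let $r\ge2$, let $P_1,\dots,P_{3^{r-1}}$ be all the collectable $r$-patterns, and let $x_1,\dots,x_{3^{r-1}}$ be positive real numbers. If $n>\prod_{i=1}^{3^{r-1}}x_i$, then every ordered $r$-matching of size $n$ contains a $P_i$-clique of size greater than $x_i2^{-m(P_i)}$, for some $i\in[3^{r-1}]$.
   Context: An ordered $r$-matching of size $n$ is a set of $n$ pairwise disjoint $r$-element subsets (edges) of $[rn]$ covering $[rn]$, considered up to order-isomorphism. An $r$-pattern is an ordered $r$-matching of size two, written as a word in letters $A,B$ each occurring $r$ times. Two edges form pattern $P$ if with the induced order they are order-isomorphic to $P$. A $P$-clique is a matching in which every pair of edges forms $P$; by convention a single edge forms a $P$-clique for every $r$-pattern $P$. $P$ is collectable if $P$-cliques of every size $k\ge2$ exist. The maturity $m(P)$ of a collectable pattern is the length of the last maximal run of equal letters in its word minus $2$, or $0$ if this is negative. *)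

theory Defs
  imports Complex_Main
begin

text \<open>
  Vertices are natural numbers with their usual order. An \<open>edge_matching\<close> may live on any
  finite vertex set (for instance a subfamily of the edges of a larger matching); an
  \<open>ordered_matching\<close> of size \<open>n\<close> is one whose vertex set is exactly \<open>{1..r * n}\<close>.
\<close>

definition edge_matching :: "nat \<Rightarrow> nat set set \<Rightarrow> bool" where
  "edge_matching r M \<longleftrightarrow> finite M \<and> (\<forall>e\<in>M. finite e \<and> card e = r) \<and> pairwise disjnt M"

definition ordered_matching :: "nat \<Rightarrow> nat \<Rightarrow> nat set set \<Rightarrow> bool" where
  "ordered_matching r n M \<longleftrightarrow> edge_matching r M \<and> card M = n \<and> \<Union>M = {1..r * n}"

definition order_isomorphic :: "nat set set \<Rightarrow> nat set set \<Rightarrow> bool" where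
  "order_isomorphic M N \<longleftrightarrow>
     (\<exists>\<phi>. strict_mono_on (\<Union>M) \<phi> \<and> (\<lambda>e. \<phi> ` e) ` M = N)"

datatype letter = LA | LB

text \<open>
  The two edges of a pattern are not labelled, so a word and the word obtained from it by
  exchanging the two letters describe the same pattern. Each pattern is represented by its
  unique word beginning with \<open>LA\<close>.
\<close>

definition is_pattern :: "nat \<Rightarrow> letter list \<Rightarrow> bool" where
  "is_pattern r w \<longleftrightarrow>
     count_list w LA = r \<and> count_list w LB = r \<and> w \<noteq> [] \<and> hd w = LA"

definition letter_positions :: "letter list \<Rightarrow> letter \<Rightarrow> nat set" where
  "letter_positions w c = {i \<in> {1..length w}. w ! (i - 1) = c}"

definition word_matching :: "letter list \<Rightarrow> nat set set" where
  "word_matching w = {letter_positions w LA, letter_positions w LB}"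

definition forms_pattern :: "nat set \<Rightarrow> nat set \<Rightarrow> letter list \<Rightarrow> bool" where
  "forms_pattern e f w \<longleftrightarrow> order_isomorphic {e, f} (word_matching w)"

definition pattern_clique :: "nat \<Rightarrow> letter list \<Rightarrow> nat set set \<Rightarrow> bool" where
  "pattern_clique r w Q \<longleftrightarrow>
     edge_matching r Q \<and> (\<forall>e\<in>Q. \<forall>f\<in>Q. e \<noteq> f \<longrightarrow> forms_pattern e f w)"

definition collectable :: "nat \<Rightarrow> letter list \<Rightarrow> bool" where
  "collectable r w \<longleftrightarrow>
     is_pattern r w \<and> (\<forall>k\<ge>2. \<exists>Q. ordered_matching r k Q \<and> pattern_clique r w Q)"

definition last_run_length :: "letter list \<Rightarrow> nat" where
  "last_run_length w = length (takeWhile (\<lambda>c. c = last w) (rev w))"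

text \<open>The subtraction is on natural numbers, hence yields 0 when the last run has length 1.\<close>

definition maturity :: "letter list \<Rightarrow> nat" where
  "maturity w = last_run_length w - 2"

end

theory Submission
  imports Defs
begin

text \<open>
  Induction on \<open>r\<close>: delete the last vertex \<open>y\<^sub>i\<close> of every edge and find a
  large clique for some collectable pattern of the shortened edges, whose last block has size
  \<open>c\<close>, say. In this clique the last blocks \<open>[a\<^sub>i, b\<^sub>i]\<close> of the edges are
  disjoint intervals, so every \<open>y\<^sub>i\<close> lies strictly inside at most one of them. Joining
  \<open>i\<close> to that interval gives a forest, and half of the edges are independent in it; for
  \<open>c = 1\<close> there is nothing to lose. This halving, once for each enlargement of a block of
  size at least 2, is the origin of the factor \<open>2\<^bsup>-m\<^esup>\<close>. Afterwards Mirsky's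
  theorem for the relation \<open>y\<^sub>i < a\<^sub>j\<close> yields either a large chain, in which the last
  block grows to size \<open>c + 1\<close>, or a large family in which all \<open>y\<^sub>i\<close> lie behind all
  shortened edges. In the latter case the Erdos-Szekeres argument makes the \<open>y\<^sub>i\<close>
  monotone and appends a block of size 1 of either orientation. The \<open>3\<^bsup>r-1\<^esup>\<close> words
  reached in this way are distinct and collectable, so by counting there are no others.
\<close>

section \<open>Chains and antichains, and independent sets in forests\<close>

text \<open>Mirsky's argument: grade each element by the size \<open>h a\<close> of a largest chain
  with top \<open>a\<close>. Related elements have different heights, so if no chain exceeds
  \<alpha> there are at most \<alpha> levels, and each level is an antichain. Real thresholds avoid
  rounding when they are later products and quotients.\<close>

lemma chain_or_antichain:
  fixes R :: "'a \<Rightarrow> 'a \<Rightarrow> bool" and \<alpha> \<beta> :: real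
  assumes fin: "finite S"
    and irr: "\<And>a. a \<in> S \<Longrightarrow> \<not> R a a"
    and tr: "\<And>a b c. \<lbrakk>a \<in> S; b \<in> S; c \<in> S; R a b; R b c\<rbrakk> \<Longrightarrow> R a c"
    and pos: "\<alpha> > 0" "\<beta> > 0" and big: "real (card S) > \<alpha> * \<beta>"
  shows "(\<exists>T\<subseteq>S. real (card T) > \<alpha> \<and> (\<forall>a\<in>T. \<forall>b\<in>T. a \<noteq> b \<longrightarrow> R a b \<or> R b a)) \<or>
         (\<exists>T\<subseteq>S. real (card T) > \<beta> \<and> (\<forall>a\<in>T. \<forall>b\<in>T. \<not> R a b))"
proof (rule ccontr)
  assume neg: "\<not> ?thesis"
  define chain where "chain a T \<longleftrightarrow> T \<subseteq> S \<and> a \<in> T \<and> (\<forall>b\<in>T. b \<noteq> a \<longrightarrow> R b a) \<and>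
    (\<forall>b\<in>T. \<forall>c\<in>T. b \<noteq> c \<longrightarrow> R b c \<or> R c b)" for a T
  define h where "h a = Max (card ` {T. chain a T})" for a
  have finc: "finite {T. chain a T}" for a
    by (rule finite_subset[of _ "Pow S"]) (auto simp: chain_def fin)
  have ex: "chain a {a}" if "a \<in> S" for a using that by (auto simp: chain_def)
  have hattain: "\<exists>T. chain a T \<and> card T = h a" if "a \<in> S" for a
    using Max_in[of "card ` {T. chain a T}"] finc ex[OF that] unfolding h_def by fastforce
  have hge: "card T \<le> h a" if "chain a T" for a T
    unfolding h_def using that finc by (intro Max_ge) auto
  have hpos: "h a \<ge> 1" if "a \<in> S" for a using hge[OF ex[OF that]] by simp
  have hle: "real (h a) \<le> \<alpha>" if "a \<in> S" for a
  proof -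
    obtain T where T: "chain a T" "card T = h a" using hattain[OF \<open>a \<in> S\<close>] by blast
    then have "T \<subseteq> S" "\<forall>b\<in>T. \<forall>c\<in>T. b \<noteq> c \<longrightarrow> R b c \<or> R c b" by (simp_all add: chain_def)
    then show ?thesis using neg T(2) by (metis not_le)
  qed
  have hmono: "h a < h b" if "a \<in> S" "b \<in> S" "R a b" for a b
  proof -
    obtain T where T: "chain a T" "card T = h a" using hattain[OF \<open>a \<in> S\<close>] by blast
    have TS: "T \<subseteq> S" "finite T" using T(1) finite_subset[OF _ fin] by (simp_all add: chain_def)
    have Rb: "R t b" if "t \<in> T" for t
      using T(1) that \<open>R a b\<close> \<open>a \<in> S\<close> \<open>b \<in> S\<close> tr[of t a b] by (cases "t = a") (auto simp: chain_def)
    have nb: "b \<notin> T" using Rb irr[OF \<open>b \<in> S\<close>] by blast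
    have "\<forall>c\<in>T. \<forall>d\<in>T. c \<noteq> d \<longrightarrow> R c d \<or> R d c" using T(1) by (simp add: chain_def)
    then have "chain b (insert b T)"
      using TS(1) Rb \<open>b \<in> S\<close> unfolding chain_def by blast
    from hge[OF this] show ?thesis using nb TS T(2) by simp
  qed
  have cls: "real (card {a\<in>S. h a = m}) \<le> \<beta>" for m
  proof -
    have "\<not> R a b" if "a \<in> {a\<in>S. h a = m}" "b \<in> {a\<in>S. h a = m}" for a b
      using hmono[of a b] that by auto
    moreover have "{a\<in>S. h a = m} \<subseteq> S" by blast
    ultimately show ?thesis using neg by (meson not_le)
  qed
  define K where "K = nat \<lfloor>\<alpha>\<rfloor>"
  have im: "h ` S \<subseteq> {1..K}" using hpos hle pos by (auto simp: K_def le_nat_floor)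
  have "card S = (\<Sum>m\<in>{1..K}. card {a\<in>S. h a = m})"
    using sum.group[OF fin _ im, of "\<lambda>_. 1::nat"] by simp
  then have "real (card S) = (\<Sum>m\<in>{1..K}. real (card {a\<in>S. h a = m}))" by simp
  also have "\<dots> \<le> (\<Sum>m\<in>{1..K}. \<beta>)" by (intro sum_mono cls)
  also have "\<dots> = real K * \<beta>" by simp
  also have "\<dots> \<le> \<alpha> * \<beta>" using pos by (intro mult_right_mono) (auto simp: K_def)
  finally show False using big by simp
qed

text \<open>Arrows raise the rank and every vertex emits at most one, so \<open>G\<close> is a
  forest and a greedy colouring needs two colours.\<close>

lemma ranked_two_colouring:
  fixes \<rho> :: "'a \<Rightarrow> nat"
  assumes "finite S"
    and "\<And>i j. \<lbrakk>i \<in> S; j \<in> S; G i j\<rbrakk> \<Longrightarrow> \<rho> i < \<rho> j"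
    and "\<And>i j k. \<lbrakk>i \<in> S; j \<in> S; k \<in> S; G i j; G i k\<rbrakk> \<Longrightarrow> j = k"
  shows "\<exists>col :: 'a \<Rightarrow> bool. \<forall>i\<in>S. \<forall>j\<in>S. G i j \<longrightarrow> col i \<noteq> col j"
  using assms
\<comment> \<open>The minus sign makes vertices enter by decreasing rank. No arrow then points to
  the new vertex \<open>z\<close>, and at most one leaves it, so only one earlier colour must be
  avoided.\<close>
proof (induction S rule: finite_ranking_induct[where f = "\<lambda>i. - int (\<rho> i)"])
  case empty
  then show ?case by simp
next
  case (insert z S)
  have "\<exists>col :: 'a \<Rightarrow> bool. \<forall>i\<in>S. \<forall>j\<in>S. G i j \<longrightarrow> col i \<noteq> col j"
    using insert.prems by (intro insert.IH) blast+
  then obtain col :: "'a \<Rightarrow> bool" where col: "\<And>i j. \<lbrakk>i\<in>S; j\<in>S; G i j\<rbrakk> \<Longrightarrow> col i \<noteq> col j"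
    by blast
  have into: "\<not> G i z" if "i \<in> insert z S" for i
    using insert.prems(1)[of i z] insert.hyps(2)[of i] that by fastforce
  show ?case
  proof (cases "\<exists>j\<in>S. G z j")
    case True
    then obtain j where j: "j \<in> S" "G z j" by blast
    have uniq: "k = j" if "k \<in> S" "G z k" for k
      using insert.prems(2)[of z k j] j that by blast
    let ?col = "col(z := \<not> col j)"
    have "?col i \<noteq> ?col k" if ik: "i \<in> insert z S" "k \<in> insert z S" "G i k" for i k
    proof -
      have "k \<noteq> z" using into ik by blast
      then show ?thesis using ik uniq[of k] col[of i k] by (cases "i = z") auto
    qed
    then show ?thesis by blast
  next
    case False
    then have "\<forall>i\<in>insert z S. \<forall>k\<in>insert z S. G i k \<longrightarrow> col i \<noteq> col k"
      using into col by blast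
    then show ?thesis by blast
  qed
qed

lemma independent_half:
  fixes \<rho> :: "'a \<Rightarrow> nat"
  assumes fin: "finite S"
    and "\<And>i j. \<lbrakk>i \<in> S; j \<in> S; G i j\<rbrakk> \<Longrightarrow> \<rho> i < \<rho> j"
    and "\<And>i j k. \<lbrakk>i \<in> S; j \<in> S; k \<in> S; G i j; G i k\<rbrakk> \<Longrightarrow> j = k"
  obtains T where "T \<subseteq> S" "card S \<le> 2 * card T" "\<And>i j. \<lbrakk>i \<in> T; j \<in> T\<rbrakk> \<Longrightarrow> \<not> G i j"
proof -
  from ranked_two_colouring[of S G \<rho>, OF assms]
  obtain col :: "'a \<Rightarrow> bool" where col: "\<forall>i\<in>S. \<forall>j\<in>S. G i j \<longrightarrow> col i \<noteq> col j"
    by (rule exE)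
  let ?T = "{i\<in>S. col i}" and ?F = "{i\<in>S. \<not> col i}"
  have "card (?T \<union> ?F) = card ?T + card ?F" using fin by (intro card_Un_disjoint) auto
  moreover have "?T \<union> ?F = S" by auto
  ultimately have "card S = card ?T + card ?F" by simp
  then have half: "card S \<le> 2 * card ?T \<or> card S \<le> 2 * card ?F" by linarith
  have indep_T: "\<not> G i j" if "i \<in> ?T" "j \<in> ?T" for i j
    using bspec[OF bspec[OF col], of i j] that by simp
  have indep_F: "\<not> G i j" if "i \<in> ?F" "j \<in> ?F" for i j
    using bspec[OF bspec[OF col], of i j] that by simp
  from half show ?thesis
  proof
    assume "card S \<le> 2 * card ?T"
    show ?thesis by (rule that[of ?T]) (simp, fact+)
  next
    assume "card S \<le> 2 * card ?F"
    show ?thesis by (rule that[of ?F]) (simp, fact+)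
  qed
qed

section \<open>Block words and their enumeration\<close>

text \<open>
  A block \<open>(c, s)\<close> stands for \<open>A\<^sup>c B\<^sup>c\<close> if \<open>s\<close> holds and for
  \<open>B\<^sup>c A\<^sup>c\<close> otherwise. A list of blocks is read from right to left, so that its head is the
  last block of the word.
\<close>

fun block_word :: "nat \<times> bool \<Rightarrow> letter list" where
  "block_word (c, s) =
     (if s then replicate c LA @ replicate c LB else replicate c LB @ replicate c LA)"

fun blocks_word :: "(nat \<times> bool) list \<Rightarrow> letter list" where
  "blocks_word [] = []"
| "blocks_word (b # bs) = blocks_word bs @ block_word b"

definition width :: "(nat \<times> bool) list \<Rightarrow> nat" where
  "width bs = sum_list (map fst bs)"

lemma width_simps [simp]: "width [] = 0" "width (b # bs) = fst b + width bs"
  by (simp_all add: width_def)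

fun extend_last :: "(nat \<times> bool) list \<Rightarrow> (nat \<times> bool) list" where
  "extend_last [] = []"
| "extend_last ((c, s) # bs) = (Suc c, s) # bs"

text \<open>The index is the edge size minus 1. The three images are the three outcomes of adding a
  last vertex to every edge of a clique: the last block grows, or a block of size 1 is appended in
  one of two orientations. The orientation of the initial block is fixed so that words start with
  \<open>LA\<close>.\<close>

primrec block_lists :: "nat \<Rightarrow> (nat \<times> bool) list set" where
  "block_lists 0 = {[(1, True)]}"
| "block_lists (Suc k) = extend_last ` block_lists k \<union>
     (Cons (1, True) ` block_lists k \<union> Cons (1, False) ` block_lists k)"

lemma block_lists_props:
  assumes "bs \<in> block_lists k"
  shows "bs \<noteq> [] \<and> width bs = Suc k \<and> (\<forall>b\<in>set bs. fst b \<ge> 1) \<and> snd (last bs)"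
  using assms
proof (induction k arbitrary: bs)
  case 0
  then show ?case by simp
next
  case (Suc k)
  then consider cs where "cs \<in> block_lists k" "bs = extend_last cs"
    | cs s where "cs \<in> block_lists k" "bs = (1, s) # cs" by auto
  then show ?case
  proof cases
    case 1
    then obtain c s ds where "cs = (c, s) # ds" using Suc.IH[of cs] by (cases cs) auto
    then show ?thesis using 1 Suc.IH[of cs] by (auto split: if_splits)
  next
    case 2
    then show ?thesis using Suc.IH[of cs] by auto
  qed
qed

lemma block_lists_Cons:
  assumes "bs \<in> block_lists k"
  obtains c s ds where "bs = (c, s) # ds" "c \<ge> 1" "c + width ds = Suc k"
  using block_lists_props[OF assms] by (cases bs) auto

lemma finite_block_lists: "finite (block_lists k)"
  by (induction k) auto

text \<open>Groups the factors by parent. This is how the thresholds of three words combine into the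
  threshold of their parent in the main induction.\<close>

lemma prod_block_lists_Suc:
  fixes f :: "(nat \<times> bool) list \<Rightarrow> 'a :: comm_monoid_mult"
  shows "prod f (block_lists (Suc k)) =
    (\<Prod>bs\<in>block_lists k. f (extend_last bs) * (f ((1, True) # bs) * f ((1, False) # bs)))"
proof -
  have inj: "inj_on extend_last (block_lists k)"
    by (rule inj_onI) (auto elim!: block_lists_Cons)
  have d1: "Cons (1, True) ` block_lists k \<inter> Cons (1, False) ` block_lists k = {}" by auto
  \<comment> \<open>The head of an extended list has size at least 2, that of a lengthened list has
    size 1.\<close>
  have d2: "extend_last ` block_lists k \<inter>
     (Cons (1, True) ` block_lists k \<union> Cons (1, False) ` block_lists k) = {}"
    by (auto elim!: block_lists_Cons)
  show ?thesis
    unfolding block_lists.simps prod.distrib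
    using inj d1 d2 finite_block_lists[of k]
    by (simp add: prod.union_disjoint prod.reindex o_def)
qed

text \<open>A product of constants 2 is 2 to the power of the cardinality, so the product recursion
  also yields the count.\<close>

lemma card_block_lists: "card (block_lists k) = 3 ^ k"
proof -
  have "(\<Prod>bs\<in>block_lists k. 2 :: nat) = 2 ^ (3 ^ k)"
  proof (induction k)
    case (Suc k)
    have "(\<Prod>bs\<in>block_lists (Suc k). 2 :: nat) = (\<Prod>bs\<in>block_lists k. 2 ^ 3)"
      by (simp only: prod_block_lists_Suc) simp
    also have "\<dots> = (\<Prod>bs\<in>block_lists k. 2) ^ 3"
      by (rule prod_power_distrib[symmetric])
    finally show ?case using Suc by (simp only: power_mult[symmetric] power_Suc mult.commute)
  qed simp
  then show ?thesis by simp
qed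

text \<open>The two nonempty halves of a block carry different letters, so the final run cannot
  reach beyond the last half block, whatever \<open>u\<close> is.\<close>

lemma last_run_length_snoc_block:
  assumes "c \<ge> 1"
  shows "last_run_length (u @ block_word (c, s)) = c"
    and "last (u @ block_word (c, s)) = (if s then LB else LA)"
proof -
  obtain d where d: "c = Suc d" using assms by (cases c) auto
  have tw: "takeWhile (\<lambda>z. z = a) (replicate c a @ replicate c b @ v) = replicate c a"
    if "a \<noteq> b" for a b :: letter and v
    using that by (simp add: takeWhile_append d)
  show 2: "last (u @ block_word (c, s)) = (if s then LB else LA)"
    by (simp add: d last_append)
  show "last_run_length (u @ block_word (c, s)) = c"
    unfolding last_run_length_def 2 by (simp add: tw)
qed

lemma maturity_blocks_word:
  assumes "c \<ge> 1"
  shows "maturity (blocks_word ((c, s) # bs)) = c - 2"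
  unfolding maturity_def blocks_word.simps by (simp only: last_run_length_snoc_block[OF assms])

text \<open>A word is decoded from its end: the last run gives the size of the last block, the last
  letter its orientation. Removing that block leaves a shorter instance.\<close>

lemma blocks_word_eq_iff:
  assumes "\<forall>b\<in>set bs. fst b \<ge> 1" "\<forall>b\<in>set cs. fst b \<ge> 1"
  shows "blocks_word bs = blocks_word cs \<longleftrightarrow> bs = cs"
  using assms
proof (induction bs arbitrary: cs)
  case Nil
  then show ?case by (cases cs) (auto split: if_splits)
next
  case (Cons b bs)
  obtain c s where b: "b = (c, s)" by fastforce
  show ?case
  proof (cases cs)
    case Nil
    then show ?thesis using Cons.prems b by auto
  next
    case (Cons b' ds)
    obtain c' s' where b': "b' = (c', s')" by fastforce
    have pos: "c \<ge> 1" "c' \<ge> 1" using Cons.prems Cons b b' by auto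
    have "c = c' \<and> s = s'" if "blocks_word (b # bs) = blocks_word (b' # ds)"
    proof
      have eq: "blocks_word bs @ block_word (c, s) = blocks_word ds @ block_word (c', s')"
        using that b b' by simp
      show "c = c'"
        using last_run_length_snoc_block(1)[of c] last_run_length_snoc_block(1)[of c'] eq pos by metis
      show "s = s'"
        using last_run_length_snoc_block(2)[of c "blocks_word bs" s]
          last_run_length_snoc_block(2)[of c' "blocks_word ds" s'] eq pos
        by (metis letter.distinct(1))
    qed
    then show ?thesis using Cons.IH[of ds] Cons.prems Cons b b' by auto
  qed
qed

lemma inj_on_blocks_word: "inj_on blocks_word (block_lists k)"
  by (rule inj_onI) (use block_lists_props blocks_word_eq_iff in blast)

lemma is_pattern_blocks_word:
  assumes "bs \<in> block_lists k"
  shows "is_pattern (Suc k) (blocks_word bs)"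
proof -
  have rep: "count_list (replicate m b) a = (if a = b then m else 0)" for m and a b :: letter
    by (induction m) auto
  have cnt: "count_list (blocks_word cs) a = width cs" for cs a
  proof (induction cs)
    case (Cons b cs)
    then show ?case by (cases b; cases a) (auto simp: count_list_append rep)
  qed simp
  have hd: "blocks_word cs \<noteq> [] \<and> hd (blocks_word cs) = LA"
    if "cs \<noteq> []" "\<forall>b\<in>set cs. fst b \<ge> 1" "snd (last cs)" for cs
    using that
  proof (induction cs)
    case (Cons b cs)
    then show ?case by (cases "cs = []"; cases b) (auto simp: hd_append)
  qed simp
  show ?thesis
    using block_lists_props[OF assms] hd[of bs] cnt by (auto simp: is_pattern_def)
qed

section \<open>The word formed by a pair of edges\<close>

text \<open>Meaningful for disjoint \<open>e\<close> and \<open>f\<close> only: a common vertex is read as \<open>LA\<close>.\<close>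

definition merge_word :: "nat set \<Rightarrow> nat set \<Rightarrow> letter list" where
  "merge_word e f = map (\<lambda>v. if v \<in> e then LA else LB) (sorted_list_of_set (e \<union> f))"

lemma forms_pattern_merge_word:
  assumes fin: "finite e" "finite f" and disj: "e \<inter> f = {}"
  shows "forms_pattern e f (merge_word e f)"
proof -
  define L where "L = sorted_list_of_set (e \<union> f)"
  define n where "n = length L"
  have setL: "set L = e \<union> f" and srt: "sorted_wrt (<) L" using fin by (simp_all add: L_def)
  have mono: "L ! i < L ! j" if "i < j" "j < n" for i j
    using sorted_wrt_nth_less[OF srt] that by (simp add: n_def)
  have inj: "inj_on ((!) L) {..<n}"
    by (rule linorder_inj_onI) (auto dest: mono)
  have im: "(!) L ` {..<n} = e \<union> f" using setL nth_image[of "length L" L] by (simp add: n_def lessThan_atLeast0)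
  \<comment> \<open>The isomorphism sends a vertex to its position in the sorted union;
    \<open>Suc\<close> converts list indices from 0 into letter positions from 1.\<close>
  define \<phi> where "\<phi> v = Suc (inv_into {..<n} ((!) L) v)" for v
  have \<phi>1: "\<phi> v \<in> {1..n}" "L ! (\<phi> v - 1) = v" if "v \<in> e \<union> f" for v
    using inv_into_into[of v "(!) L" "{..<n}"] f_inv_into_f[of v "(!) L" "{..<n}"] im that
    by (auto simp: \<phi>_def)
  have \<phi>2: "\<phi> (L ! (i - 1)) = i" if "i \<in> {1..n}" for i
    using inv_into_f_f[OF inj, of "i - 1"] that by (auto simp: \<phi>_def)
  have "strict_mono_on (e \<union> f) \<phi>"
  proof (rule strict_mono_onI)
    fix u v assume uv: "u \<in> e \<union> f" "v \<in> e \<union> f" "u < v"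
    show "\<phi> u < \<phi> v"
    proof (rule ccontr)
      assume "\<not> \<phi> u < \<phi> v"
      then have "\<phi> v = \<phi> u \<or> \<phi> v - 1 < \<phi> u - 1" using \<phi>1[OF uv(1)] \<phi>1[OF uv(2)] by auto
      moreover have "\<phi> u - 1 < n" using \<phi>1(1)[OF uv(1)] by auto
      ultimately show False
        using mono[of "\<phi> v - 1" "\<phi> u - 1"] \<phi>1(2)[OF uv(1)] \<phi>1(2)[OF uv(2)] uv(3) by auto
    qed
  qed
  \<comment> \<open>A general predicate covers both edges: membership in \<open>e\<close> gives the
    positions of \<open>LA\<close>, its negation those of \<open>LB\<close>.\<close>
  moreover have pos: "\<phi> ` {v \<in> e \<union> f. P v} = {i\<in>{1..n}. P (L ! (i - 1))}" for P
  proof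
    show "\<phi> ` {v \<in> e \<union> f. P v} \<subseteq> {i\<in>{1..n}. P (L ! (i - 1))}" using \<phi>1 by auto
    show "{i\<in>{1..n}. P (L ! (i - 1))} \<subseteq> \<phi> ` {v \<in> e \<union> f. P v}"
    proof
      fix i assume i: "i \<in> {i\<in>{1..n}. P (L ! (i - 1))}"
      then have "L ! (i - 1) \<in> e \<union> f" using im by auto
      then show "i \<in> \<phi> ` {v \<in> e \<union> f. P v}"
        using i \<phi>2[of i] by (intro image_eqI[of _ _ "L ! (i - 1)"]) auto
    qed
  qed
  have len: "length (merge_word e f) = n" by (simp add: merge_word_def n_def L_def)
  have nth: "merge_word e f ! (i - 1) = (if L ! (i - 1) \<in> e then LA else LB)" if "i \<in> {1..n}" for i
    using that by (auto simp: merge_word_def n_def L_def)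
  have "\<phi> ` e = letter_positions (merge_word e f) LA"
  proof -
    have "{v \<in> e \<union> f. v \<in> e} = e" by auto
    moreover have "{i\<in>{1..n}. L ! (i - 1) \<in> e} = letter_positions (merge_word e f) LA"
      unfolding letter_positions_def len by (intro Collect_cong conj_cong refl) (simp add: nth del: One_nat_def)
    ultimately show ?thesis using pos[of "\<lambda>v. v \<in> e"] by simp
  qed
  moreover have "\<phi> ` f = letter_positions (merge_word e f) LB"
  proof -
    have "{v \<in> e \<union> f. v \<notin> e} = f" using disj by auto
    moreover have "{i\<in>{1..n}. L ! (i - 1) \<notin> e} = letter_positions (merge_word e f) LB"
      unfolding letter_positions_def len by (intro Collect_cong conj_cong refl) (simp add: nth del: One_nat_def)
    ultimately show ?thesis using pos[of "\<lambda>v. v \<notin> e"] by simp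
  qed
  ultimately show ?thesis
    unfolding forms_pattern_def order_isomorphic_def word_matching_def
    by (intro exI[of _ \<phi>]) auto
qed

lemma forms_pattern_commute: "forms_pattern e f w \<longleftrightarrow> forms_pattern f e w"
  by (simp add: forms_pattern_def insert_commute)

lemma sorted_list_of_set_Un_less:
  fixes A B :: "nat set"
  assumes "finite A" "finite B" "\<And>a b. \<lbrakk>a \<in> A; b \<in> B\<rbrakk> \<Longrightarrow> a < b"
  shows "sorted_list_of_set (A \<union> B) = sorted_list_of_set A @ sorted_list_of_set B"
  by (rule strict_sorted_equal) (use assms in \<open>auto simp: sorted_wrt_append\<close>)

lemma merge_word_append:
  assumes fin: "finite e1" "finite f1" "finite e2" "finite f2"
    and less: "\<And>a b. \<lbrakk>a \<in> e1 \<union> f1; b \<in> e2 \<union> f2\<rbrakk> \<Longrightarrow> a < b"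
  shows "merge_word (e1 \<union> e2) (f1 \<union> f2) = merge_word e1 f1 @ merge_word e2 f2"
proof -
  have "e1 \<union> e2 \<union> (f1 \<union> f2) = (e1 \<union> f1) \<union> (e2 \<union> f2)" by auto
  then have "sorted_list_of_set (e1 \<union> e2 \<union> (f1 \<union> f2)) =
      sorted_list_of_set (e1 \<union> f1) @ sorted_list_of_set (e2 \<union> f2)"
    using sorted_list_of_set_Un_less[of "e1 \<union> f1" "e2 \<union> f2"] fin less by simp
  then show ?thesis
    using fin less by (force simp: merge_word_def)
qed

lemma merge_word_block:
  assumes fin: "finite e" "finite f" and card: "card e = c" "card f = c"
    and less: "\<And>a b. \<lbrakk>a \<in> e; b \<in> f\<rbrakk> \<Longrightarrow> if s then a < b else b < a"
  shows "merge_word e f = block_word (c, s)"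
proof -
  have disj: "e \<inter> f = {}" using less by (force split: if_splits)
  have "sorted_list_of_set (e \<union> f) = (if s then sorted_list_of_set e @ sorted_list_of_set f
      else sorted_list_of_set f @ sorted_list_of_set e)"
    using sorted_list_of_set_Un_less[of e f] sorted_list_of_set_Un_less[of f e] fin less
    by (auto simp: Un_commute)
  moreover have "map (\<lambda>v. if v \<in> e then LA else LB) (sorted_list_of_set e) = replicate c LA"
    using fin card by (subst map_cong[OF refl, of _ _ "\<lambda>_. LA"]) (auto simp: map_replicate_const)
  moreover have "map (\<lambda>v. if v \<in> e then LA else LB) (sorted_list_of_set f) = replicate c LB"
    using fin card disj
    by (subst map_cong[OF refl, of _ _ "\<lambda>_. LB"]) (auto simp: map_replicate_const)
  ultimately show ?thesis by (simp add: merge_word_def)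
qed

section \<open>Fitting a block word by comparing block ends\<close>

text \<open>
  The vertices of an edge are numbered from 0, and \<open>u\<close> is the edge of the letter
  \<open>LA\<close>. For strictly increasing \<open>u\<close> and \<open>v\<close> it suffices to compare the
  first and last vertices of the blocks.
\<close>

fun fits :: "(nat \<times> bool) list \<Rightarrow> (nat \<Rightarrow> nat) \<Rightarrow> (nat \<Rightarrow> nat) \<Rightarrow> bool" where
  "fits [] u v \<longleftrightarrow> True"
| "fits ((c, s) # bs) u v \<longleftrightarrow> fits bs u v \<and>
     (\<forall>j < width bs. u j < v (width bs) \<and> v j < u (width bs)) \<and>
     (if s then u (width bs + c - 1) < v (width bs) else v (width bs + c - 1) < u (width bs))"

lemma merge_word_fits:
  assumes "fits bs u v" "strict_mono_on {..<width bs} u" "strict_mono_on {..<width bs} v"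
    "\<forall>b\<in>set bs. fst b \<ge> 1"
  shows "merge_word (u ` {..<width bs}) (v ` {..<width bs}) = blocks_word bs"
  using assms
proof (induction bs)
  case Nil
  then show ?case by (simp add: merge_word_def)
next
  case (Cons b bs)
  obtain c s where b: "b = (c, s)" by fastforce
  define q where "q = width bs"
  have c: "c \<ge> 1" using Cons.prems b by auto
  have mono: "w i < w j" if "w \<in> {u, v}" "i < j" "j < q + c" for w i j
    using strict_mono_onD[OF Cons.prems(2), of i j] strict_mono_onD[OF Cons.prems(3), of i j] that b
    by (auto simp: q_def add.commute)
  have le: "w i \<le> w j" if "w \<in> {u, v}" "i \<le> j" "j < q + c" for w i j
    using mono[of w i j] that by (cases "i = j") auto
  have inj: "inj_on w {q..<q + c}" if "w \<in> {u, v}" for w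
    by (rule linorder_inj_onI) (use mono[OF that] in force)+
  have fit: "fits bs u v" "\<And>j. j < q \<Longrightarrow> u j < v q \<and> v j < u q"
     "if s then u (q + c - 1) < v q else v (q + c - 1) < u q"
    using Cons.prems(1) b by (auto simp: q_def split: if_splits)
  have split: "w ` {..<width (b # bs)} = w ` {..<q} \<union> w ` {q..<q + c}" for w :: "nat \<Rightarrow> nat"
  proof -
    have "{..<width (b # bs)} = {..<q} \<union> {q..<q + c}" by (auto simp: b q_def)
    then show ?thesis by (simp add: image_Un)
  qed
  have ih: "merge_word (u ` {..<q}) (v ` {..<q}) = blocks_word bs"
    unfolding q_def
  proof (rule Cons.IH)
    show "strict_mono_on {..<width bs} u" "strict_mono_on {..<width bs} v"
      using mono[of u] mono[of v] by (auto intro!: strict_mono_onI simp: q_def)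
  qed (use Cons.prems fit in auto)
  have blk: "merge_word (u ` {q..<q + c}) (v ` {q..<q + c}) = block_word (c, s)"
  proof (rule merge_word_block)
    fix a a' assume a: "a \<in> u ` {q..<q + c}" "a' \<in> v ` {q..<q + c}"
    then obtain i j where ij: "a = u i" "a' = v j" "q \<le> i" "i < q + c" "q \<le> j" "j < q + c" by auto
    have "u i \<le> u (q + c - 1)" "v j \<le> v (q + c - 1)" "u q \<le> u i" "v q \<le> v j"
      using le[of u i "q + c - 1"] le[of v j "q + c - 1"] le[of u q i] le[of v q j] ij c by auto
    then show "if s then a < a' else a' < a" using fit(3) ij by (auto split: if_splits)
  qed (auto simp: card_image inj)
  have "merge_word (u ` {..<q} \<union> u ` {q..<q + c}) (v ` {..<q} \<union> v ` {q..<q + c}) =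
     merge_word (u ` {..<q}) (v ` {..<q}) @ merge_word (u ` {q..<q + c}) (v ` {q..<q + c})"
  proof (rule merge_word_append)
    \<comment> \<open>It suffices to compare with vertex \<open>q\<close>, the first of the last
      block: within one edge this is monotonicity, across the edges it is the middle condition of
      \<open>fits\<close>.\<close>
    fix a a' assume a: "a \<in> u ` {..<q} \<union> v ` {..<q}" "a' \<in> u ` {q..<q + c} \<union> v ` {q..<q + c}"
    from a(1) obtain i w where i: "i < q" "w \<in> {u, v}" "a = w i" by auto
    from a(2) obtain w' where w': "w' \<in> {u, v}" "a' \<in> w' ` {q..<q + c}" by blast
    then obtain j where j: "q \<le> j" "j < q + c" "w' \<in> {u, v}" "a' = w' j" by auto
    have "w i < w' q" using fit(2)[OF i(1)] mono[of w i q] i j c by auto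
    also have "\<dots> \<le> w' j" using le[of w' q j] j by blast
    finally show "a < a'" using i j by simp
  qed auto
  then show ?case using ih blk split[of u] split[of v] b by simp
qed

lemma fits_forms_pattern:
  assumes bs: "bs \<in> block_lists k" and "fits bs u v"
    and "strict_mono_on {..k} u" "strict_mono_on {..k} v"
    and disj: "u ` {..k} \<inter> v ` {..k} = {}"
  shows "forms_pattern (u ` {..k}) (v ` {..k}) (blocks_word bs)"
proof -
  have props: "width bs = Suc k" "\<forall>b\<in>set bs. fst b \<ge> 1" using block_lists_props[OF bs] by auto
  have "merge_word (u ` {..<width bs}) (v ` {..<width bs}) = blocks_word bs"
    using assms props by (intro merge_word_fits) (auto simp: lessThan_Suc_atMost)
  then show ?thesis
    using forms_pattern_merge_word[of "u ` {..k}" "v ` {..k}"] disj props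
    by (simp add: lessThan_Suc_atMost)
qed

text \<open>Words begin with \<open>LA\<close>, so the edge with the smaller first vertex takes the
  role of \<open>LA\<close>. For blocks of positive size only vertices with index below
  \<open>width bs\<close> are inspected, so one \<open>E\<close> also describes cliques of shortened
  edges.\<close>

definition clique_on :: "(nat \<times> bool) list \<Rightarrow> ('a \<Rightarrow> nat \<Rightarrow> nat) \<Rightarrow> 'a set \<Rightarrow> bool" where
  "clique_on bs E J \<longleftrightarrow> (\<forall>i\<in>J. \<forall>i'\<in>J. E i 0 < E i' 0 \<longrightarrow> fits bs (E i) (E i'))"

lemma clique_on_forms_pattern:
  assumes bs: "bs \<in> block_lists k" and cl: "clique_on bs E J"
    and mono: "\<And>i. i \<in> J \<Longrightarrow> strict_mono_on {..k} (E i)"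
    and ij: "i \<in> J" "j \<in> J" and disj: "E i ` {..k} \<inter> E j ` {..k} = {}"
  shows "forms_pattern (E i ` {..k}) (E j ` {..k}) (blocks_word bs)"
proof -
  have "E i 0 \<noteq> E j 0" using disj by auto
  then consider "E i 0 < E j 0" | "E j 0 < E i 0" by linarith
  then show ?thesis
  proof cases
    case 1
    then show ?thesis
      using cl ij mono disj by (intro fits_forms_pattern[OF bs]) (auto simp: clique_on_def)
  next
    case 2
    then have "forms_pattern (E j ` {..k}) (E i ` {..k}) (blocks_word bs)"
      using cl ij mono disj by (intro fits_forms_pattern[OF bs]) (auto simp: clique_on_def)
    then show ?thesis using forms_pattern_commute by blast
  qed
qed

section \<open>Cliques of every size for block words\<close>

text \<open>
  Vertex \<open>j\<close> of edge \<open>i < n\<close> in the clique of size \<open>n\<close> whose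
  \<open>n\<close> copies of each block are consecutive, in increasing or decreasing order of
  \<open>i\<close>.
\<close>

fun place :: "nat \<Rightarrow> (nat \<times> bool) list \<Rightarrow> nat \<Rightarrow> nat \<Rightarrow> nat" where
  "place n [] i j = 0"
| "place n ((c, s) # bs) i j =
     (if j < width bs then place n bs i j
      else Suc (n * width bs + (if s then i else n - 1 - i) * c + (j - width bs)))"

lemma place_block_bounds:
  fixes i n c l q :: nat
  assumes "i < n" "l < c"
  shows "Suc (n * q + i * c + l) \<in> {Suc (n * q)..n * (c + q)}"
proof -
  have "Suc i * c \<le> n * c" using assms by (intro mult_right_mono) auto
  then show ?thesis using assms by (auto simp: algebra_simps)
qed

lemma place_image:
  "(\<lambda>(i, j). place n bs i j) ` ({..<n} \<times> {..<width bs}) = {1..n * width bs}"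
proof (induction bs)
  case Nil
  then show ?case by simp
next
  case (Cons b bs)
  obtain c s where b: "b = (c, s)" by fastforce
  define q where "q = width bs"
  have mem: "place n bs i j \<in> {1..n * q}" if "i < n" "j < q" for i j
    using Cons.IH that by (force simp: q_def)
  show ?case
  proof (intro equalityI subsetI)
    fix v assume "v \<in> (\<lambda>(i, j). place n (b # bs) i j) ` ({..<n} \<times> {..<width (b # bs)})"
    then obtain i j where ij: "i < n" "j < c + q" "v = place n (b # bs) i j"
      by (auto simp: b q_def)
    show "v \<in> {1..n * width (b # bs)}"
    proof (cases "j < q")
      case True
      then show ?thesis using mem[of i j] ij by (auto simp: b q_def algebra_simps)
    next
      case False
      then show ?thesis
        using place_block_bounds[of "if s then i else n - 1 - i" n "j - q" c q] ij
        by (auto simp: b q_def)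
    qed
  next
    fix v assume v: "v \<in> {1..n * width (b # bs)}"
    show "v \<in> (\<lambda>(i, j). place n (b # bs) i j) ` ({..<n} \<times> {..<width (b # bs)})"
    proof (cases "v \<le> n * q")
      case True
      then have "v \<in> {1..n * width bs}" using v by (simp add: q_def)
      then obtain i j where "i < n" "j < width bs" "v = place n bs i j"
        unfolding Cons.IH[symmetric] by auto
      then show ?thesis by (intro image_eqI[of _ _ "(i, j)"]) (auto simp: b)
    next
      case False
      \<comment> \<open>Offset of \<open>v\<close> within the region of the last block, made of
        \<open>n\<close> copies of length \<open>c\<close>. The quotient by \<open>c\<close> selects
        the copy, hence the edge, and the remainder the vertex inside it.\<close>
      define m where "m = v - Suc (n * q)"
      have m: "m < n * c" "v = Suc (n * q + m)"
        using False v by (auto simp: m_def b q_def algebra_simps)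
      then have c: "c > 0" by (cases c) auto
      have t: "m div c < n" using m(1) by (simp add: less_mult_imp_div_less)
      define i where "i = (if s then m div c else n - 1 - m div c)"
      have i: "i < n" "(if s then i else n - 1 - i) = m div c" using t by (auto simp: i_def)
      have "place n (b # bs) i (q + m mod c) = v"
        using i m(2) by (simp add: b q_def)
      then show ?thesis
        using i c by (intro image_eqI[of _ _ "(i, q + m mod c)"]) (auto simp: b q_def)
    qed
  qed
qed

text \<open>The index grid and its image have equally many elements, so surjectivity forces
  injectivity.\<close>

lemma inj_on_place: "inj_on (\<lambda>(i, j). place n bs i j) ({..<n} \<times> {..<width bs})"
  by (rule eq_card_imp_inj_on) (simp_all add: place_image)

lemma place_le: "\<lbrakk>i < n; j < width bs\<rbrakk> \<Longrightarrow> place n bs i j \<le> n * width bs"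
  using place_image[of n bs] by force

lemma strict_mono_on_place:
  assumes "i < n"
  shows "strict_mono_on {..<width bs} (place n bs i)"
proof (induction bs)
  case Nil
  then show ?case by simp
next
  case (Cons b bs)
  obtain c s where b: "b = (c, s)" by fastforce
  show ?case
  proof (rule strict_mono_onI)
    fix j j' assume jj: "j \<in> {..<width (b # bs)}" "j' \<in> {..<width (b # bs)}" "j < j'"
    consider "j' < width bs" | "j < width bs" "width bs \<le> j'" | "width bs \<le> j" by linarith
    then show "place n (b # bs) i j < place n (b # bs) i j'"
    proof cases
      case 1
      then show ?thesis using strict_mono_onD[OF Cons, of j j'] jj by (auto simp: b)
    next
      case 2
      then show ?thesis using place_le[OF assms, of j bs] by (auto simp: b)
    next
      case 3
      then show ?thesis using jj by (auto simp: b)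
    qed
  qed
qed

lemma fits_cong:
  assumes "\<And>j. j < width bs \<Longrightarrow> u j = u' j" "\<And>j. j < width bs \<Longrightarrow> v j = v' j"
    "\<forall>b\<in>set bs. fst b \<ge> 1"
  shows "fits bs u v \<longleftrightarrow> fits bs u' v'"
  using assms
proof (induction bs)
  case (Cons b bs)
  then show ?case by (cases b) auto
qed simp

lemma fits_place:
  assumes "i < i'" "i' < n" "\<forall>b\<in>set bs. fst b \<ge> 1"
  shows "fits bs (place n bs i) (place n bs i')"
  using assms
proof (induction bs)
  case (Cons b bs)
  obtain c s where b: "b = (c, s)" by fastforce
  have c: "c \<ge> 1" using Cons.prems b by auto
  define q where "q = width bs"
  define u where "u = place n (b # bs) i"
  define v where "v = place n (b # bs) i'"
  have "fits bs u v \<longleftrightarrow> fits bs (place n bs i) (place n bs i')"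
    using Cons.prems by (intro fits_cong) (auto simp: b u_def v_def)
  then have fit: "fits bs u v" using Cons by simp
  have low: "u j \<le> n * q" "v j \<le> n * q" if "j < q" for j
    using that assms(1,2) place_le[of i n j bs] place_le[of i' n j bs]
    by (auto simp: u_def v_def b q_def)
  \<comment> \<open>Ranks of the two edges among the \<open>n\<close> consecutive copies of the last
    block; the orientation \<open>s\<close> decides whether they keep or reverse the order of
    \<open>i\<close> and \<open>i'\<close>.\<close>
  define t where "t = (if s then i else n - 1 - i)"
  define t' where "t' = (if s then i' else n - 1 - i')"
  have val: "u (q + l) = Suc (n * q + t * c + l)" "v (q + l) = Suc (n * q + t' * c + l)" for l
    by (simp_all add: u_def v_def b q_def t_def t'_def)
  have step: "m * c + (c - 1) < m' * c" if "m < m'" for m m'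
  proof -
    have "Suc m * c \<le> m' * c" using that by (intro mult_right_mono) auto
    then show ?thesis using c by simp
  qed
  have "if s then t < t' else t' < t" using assms(1,2) by (auto simp: t_def t'_def)
  then have "if s then u (q + c - 1) < v q else v (q + c - 1) < u q"
    using step[of t t'] step[of t' t] val[of "c - 1"] val[of 0] c by (auto split: if_splits)
  moreover have "u j < v q \<and> v j < u q" if "j < q" for j
    using low[OF that] val[of 0] by auto
  ultimately have "fits (b # bs) u v" using fit by (auto simp: b q_def split: if_splits)
  then show ?case by (simp add: u_def v_def)
qed simp

lemma collectable_blocks_word:
  assumes bs: "bs \<in> block_lists k"
  shows "collectable (Suc k) (blocks_word bs)"
  unfolding collectable_def
proof (intro conjI allI impI)
  show "is_pattern (Suc k) (blocks_word bs)" by (rule is_pattern_blocks_word[OF bs])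
next
  fix n :: nat assume "2 \<le> n"
  have props: "width bs = Suc k" "\<forall>b\<in>set bs. fst b \<ge> 1" using block_lists_props[OF bs] by auto
  define e where "e i = place n bs i ` {..k}" for i
  have mono: "strict_mono_on {..k} (place n bs i)" if "i < n" for i
    using strict_mono_on_place[OF that, of bs] props by (simp add: lessThan_Suc_atMost)
  have disj: "e i \<inter> e j = {}" if "i < n" "j < n" "i \<noteq> j" for i j
  proof (rule ccontr)
    assume "e i \<inter> e j \<noteq> {}"
    then obtain l m where "l \<le> k" "m \<le> k" "place n bs i l = place n bs j m" by (auto simp: e_def)
    then show False
      using inj_onD[OF inj_on_place[of n bs], of "(i, l)" "(j, m)"] that props by auto
  qed
  have card_e: "card (e i) = Suc k" if "i < n" for i
    using strict_mono_on_imp_inj_on[OF mono[OF that]] by (simp add: e_def card_image)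
  have ne: "e i \<noteq> {}" for i by (auto simp: e_def)
  have inj: "inj_on e {..<n}"
    using disj ne by (intro inj_onI) (metis Int_absorb lessThan_iff)
  have em: "edge_matching (Suc k) (e ` {..<n})"
    unfolding edge_matching_def pairwise_def disjnt_def
    using disj card_e by (auto simp: e_def)
  have "\<Union>(e ` {..<n}) = (\<lambda>(i, j). place n bs i j) ` ({..<n} \<times> {..<width bs})"
    using props by (auto simp: e_def lessThan_Suc_atMost)
  then have "ordered_matching (Suc k) n (e ` {..<n})"
    unfolding ordered_matching_def using em inj place_image[of n bs] props
    by (simp add: card_image mult.commute)
  moreover have fp: "forms_pattern (e i) (e j) (blocks_word bs)" if "i < j" "j < n" for i j
    unfolding e_def
    using that mono props disj[of i j] fits_place[of i j n bs]
    by (intro fits_forms_pattern[OF bs]) (auto simp: e_def)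
  have "forms_pattern (e i) (e j) (blocks_word bs)" if "i < n" "j < n" "e i \<noteq> e j" for i j
    using fp[of i j] fp[of j i] that forms_pattern_commute by (cases i j rule: linorder_cases) auto
  then have "pattern_clique (Suc k) (blocks_word bs) (e ` {..<n})"
    unfolding pattern_clique_def using em by auto
  ultimately show "\<exists>Q. ordered_matching (Suc k) n Q \<and> pattern_clique (Suc k) (blocks_word bs) Q"
    by blast
qed

section \<open>Adding a last vertex to every edge of a clique\<close>

text \<open>The product of thresholds reflects two successive dichotomies: first \<alpha> against
  \<beta>\<gamma>, for growing the last block, then \<beta> against \<gamma>, for the orientation of
  a new one. The factor 2 pays for clearing block interiors.\<close>

lemma extend_clique:
  fixes E :: "'a \<Rightarrow> nat \<Rightarrow> nat" and \<alpha> \<beta> \<gamma> :: real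
  assumes bs: "bs \<in> block_lists k" "bs = (c, s) # ds" and fin: "finite J"
    and mono: "\<And>i. i \<in> J \<Longrightarrow> strict_mono_on {..Suc k} (E i)"
    and disj: "\<And>i i' j j'. \<lbrakk>i \<in> J; i' \<in> J; i \<noteq> i'; j \<le> Suc k; j' \<le> Suc k\<rbrakk> \<Longrightarrow> E i j \<noteq> E i' j'"
    and cl: "clique_on bs E J" and pos: "\<alpha> > 0" "\<beta> > 0" "\<gamma> > 0"
    and big: "real (card J) > \<alpha> * (\<beta> * \<gamma>) * (if c \<ge> 2 then 2 else 1)"
  shows "\<exists>J'\<subseteq>J. (clique_on (extend_last bs) E J' \<and> real (card J') > \<alpha>) \<or>
    (clique_on ((1, True) # bs) E J' \<and> real (card J') > \<beta>) \<or>
    (clique_on ((1, False) # bs) E J' \<and> real (card J') > \<gamma>)"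
proof -
  \<comment> \<open>Vertices are numbered from 0, so the last block occupies indices
    \<open>q\<close> to \<open>k\<close>, with end vertices \<open>a i\<close> and
    \<open>b i\<close>; \<open>y i\<close> is the new vertex.\<close>
  define q where "q = width ds"
  define a where "a i = E i q" for i
  define b where "b i = E i k" for i
  define y where "y i = E i (Suc k)" for i
  have c: "c \<ge> 1" "c + q = Suc k" "width bs = Suc k"
    using block_lists_props[OF bs(1)] bs(2) by (auto simp: q_def)
  then have qk: "q + c - 1 = k" "q \<le> k" by auto
  have Em: "E i j < E i j'" if "i \<in> J" "j < j'" "j' \<le> Suc k" for i j j'
    using strict_mono_onD[OF mono[OF that(1)], of j j'] that by auto
  have Em': "E i j \<le> E i j'" if "i \<in> J" "j \<le> j'" "j' \<le> Suc k" for i j j'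
    using Em[of i j j'] that by (cases "j = j'") auto
  have ab: "a i \<le> b i" "b i < y i" if "i \<in> J" for i
    using Em'[OF that, of q k] Em[OF that, of k "Suc k"] qk by (auto simp: a_def b_def y_def)
  have tot: "E i 0 < E j 0 \<or> E j 0 < E i 0" if "i \<in> J" "j \<in> J" "i \<noteq> j" for i j
    using disj[OF that, of 0 0] by auto
  have sep0: "if s then b i < a j else b j < a i" if "i \<in> J" "j \<in> J" "E i 0 < E j 0" for i j
    using cl that qk(1) unfolding clique_on_def bs(2) a_def b_def q_def by auto
  have sep: "b i < a j \<or> b j < a i" if "i \<in> J" "j \<in> J" "i \<noteq> j" for i j
    using tot[OF that] sep0[of i j] sep0[of j i] that by (auto split: if_splits)
  define G where "G i j \<longleftrightarrow> a j < y i \<and> y i < b j \<and> i \<noteq> j" for i j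
  obtain T where T: "T \<subseteq> J" "real (card T) > \<alpha> * (\<beta> * \<gamma>)"
    "\<And>i j. \<lbrakk>i \<in> T; j \<in> T\<rbrakk> \<Longrightarrow> \<not> G i j"
  proof (cases "c \<ge> 2")
    case True
    obtain T where T: "T \<subseteq> J" "card J \<le> 2 * card T" "\<And>i j. \<lbrakk>i \<in> T; j \<in> T\<rbrakk> \<Longrightarrow> \<not> G i j"
    \<comment> \<open>The left end serves as rank: \<open>y i\<close> is behind \<open>b i\<close>
      and inside the block of \<open>j\<close>, so of the two disjoint blocks that of
      \<open>j\<close> comes later. Disjointness also allows at most one block around
      \<open>y i\<close>.\<close>
    proof (rule independent_half[OF fin, of G a])
      show "a i < a j" if "i \<in> J" "j \<in> J" "G i j" for i j
        using sep[of i j] ab[of i] ab[of j] that by (auto simp: G_def)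
      show "j = l" if "i \<in> J" "j \<in> J" "l \<in> J" "G i j" "G i l" for i j l
        using sep[of j l] that by (force simp: G_def)
    qed blast
    have "real (card J) \<le> 2 * real (card T)" using T(2) by linarith
    then show ?thesis using that[OF T(1) _ T(3)] big True by simp
  next
    case False
    \<comment> \<open>A block of size 1 has no interior, so no edge need be discarded.\<close>
    then have "q = k" using c by simp
    then have "\<not> G i j" for i j by (simp add: G_def a_def b_def)
    then show ?thesis using that[of J] big False by simp
  qed
  have finT: "finite T" using T(1) fin finite_subset by blast
  have TJ: "i \<in> J" if "i \<in> T" for i using T(1) that by blast
  have "(\<exists>U\<subseteq>T. real (card U) > \<alpha> \<and> (\<forall>i\<in>U. \<forall>j\<in>U. i \<noteq> j \<longrightarrow> y i < a j \<or> y j < a i)) \<or>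
      (\<exists>U\<subseteq>T. real (card U) > \<beta> * \<gamma> \<and> (\<forall>i\<in>U. \<forall>j\<in>U. \<not> y i < a j))"
  proof (rule chain_or_antichain[OF finT])
    \<comment> \<open>The inequality \<open>a j < y j\<close> links the two comparisons.\<close>
    show "y i < a l" if "i \<in> T" "j \<in> T" "l \<in> T" "y i < a j" "y j < a l" for i j l
      using ab[OF TJ, of j] that by auto
    show "\<not> y i < a i" if "i \<in> T" for i using ab[OF TJ[OF that]] by simp
  qed (use T(2) pos in simp_all)
  then consider (chain) U where "U \<subseteq> T" "real (card U) > \<alpha>"
      "\<And>i j. \<lbrakk>i \<in> U; j \<in> U; i \<noteq> j\<rbrakk> \<Longrightarrow> y i < a j \<or> y j < a i"
    | (anti) U where "U \<subseteq> T" "real (card U) > \<beta> * \<gamma>"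
      "\<And>i j. \<lbrakk>i \<in> U; j \<in> U\<rbrakk> \<Longrightarrow> \<not> y i < a j"
    by blast
  then show ?thesis
  proof cases
    case chain
    have UJ: "i \<in> J" if "i \<in> U" for i using chain(1) TJ that by blast
    have "fits (extend_last bs) (E i) (E j)" if ij: "i \<in> U" "j \<in> U" "E i 0 < E j 0" for i j
    proof -
      have *: "fits ((c, s) # ds) (E i) (E j)"
        using cl ij UJ bs(2) by (auto simp: clique_on_def)
      have "i \<noteq> j" using ij by auto
      \<comment> \<open>The chain gives one of the two orders, and the order of the old blocks in
        \<open>sep0\<close> excludes the one contradicting \<open>s\<close>.\<close>
      then have "if s then y i < a j else y j < a i"
        using chain(3)[of i j] sep0[of i j] ij UJ[of i] UJ[of j] ab[of i] ab[of j]
        by (auto split: if_splits)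
      moreover have "width ds + Suc c - 1 = Suc k" using c by (simp add: q_def)
      ultimately show ?thesis using * unfolding bs(2) extend_last.simps fits.simps
        by (auto simp: y_def a_def q_def split: if_splits)
    qed
    then have "clique_on (extend_last bs) E U" by (auto simp: clique_on_def)
    moreover have "U \<subseteq> J" using chain(1) T(1) by simp
    ultimately show ?thesis using chain(2) by (intro exI[of _ U]) simp
  next
    case anti
    have UJ: "i \<in> J" if "i \<in> U" for i using anti(1) TJ that by blast
    have finU: "finite U" using anti(1) finT finite_subset by blast
    \<comment> \<open>For distinct edges, \<open>y i\<close> is not before the last block of
      \<open>j\<close> (antichain), not inside it (independence) and not at its ends (disjointness),
      so it lies behind \<open>b j\<close>.\<close>
    have above: "E j l < y i" if "i \<in> U" "j \<in> U" "l \<le> k" for i j l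
    proof -
      have "b j < y i"
      proof (cases "i = j")
        case False
        have "y i \<noteq> a j" "y i \<noteq> b j"
          using disj[of i j "Suc k" q] disj[of i j "Suc k" k] UJ that False qk
          by (auto simp: y_def a_def b_def)
        moreover have "\<not> G i j" using T(3) that anti(1) by blast
        ultimately show ?thesis using anti(3)[of i j] that False by (auto simp: G_def)
      qed (use ab UJ that in auto)
      moreover have "E j l \<le> b j" using Em'[of j l k] UJ that by (auto simp: b_def)
      ultimately show ?thesis by simp
    qed
    have ext: "fits ((1, t) # bs) (E i) (E j)"
      if "i \<in> U" "j \<in> U" "E i 0 < E j 0" "if t then y i < y j else y j < y i" for i j t
    proof -
      have "fits bs (E i) (E j)" using cl that UJ by (auto simp: clique_on_def)
      then show ?thesis using above that c(3) by (auto simp: y_def less_Suc_eq_le split: if_splits)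
    qed
    \<comment> \<open>The Erdos-Szekeres order: along increasing first vertices, chains have
      increasing and antichains decreasing new vertices.\<close>
    define R where "R i j \<longleftrightarrow> E i 0 < E j 0 \<and> y i < y j" for i j
    have "(\<exists>V\<subseteq>U. real (card V) > \<beta> \<and> (\<forall>i\<in>V. \<forall>j\<in>V. i \<noteq> j \<longrightarrow> R i j \<or> R j i)) \<or>
      (\<exists>V\<subseteq>U. real (card V) > \<gamma> \<and> (\<forall>i\<in>V. \<forall>j\<in>V. \<not> R i j))"
      by (rule chain_or_antichain[OF finU]) (use pos anti(2) in \<open>auto simp: R_def\<close>)
    then show ?thesis
    proof (elim disjE exE conjE)
      fix V assume V: "V \<subseteq> U" "real (card V) > \<beta>"
        "\<forall>i\<in>V. \<forall>j\<in>V. i \<noteq> j \<longrightarrow> R i j \<or> R j i"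
      have "y i < y j" if "i \<in> V" "j \<in> V" "E i 0 < E j 0" for i j
        using V(3) that by (fastforce simp: R_def)
      then have "clique_on ((1, True) # bs) E V"
        using V(1) ext[where t = True] unfolding clique_on_def by (meson subsetD)
      moreover have "V \<subseteq> J" using V(1) anti(1) T(1) by simp
      ultimately show ?thesis using V(2) by (intro exI[of _ V]) simp
    next
      fix V assume V: "V \<subseteq> U" "real (card V) > \<gamma>" "\<forall>i\<in>V. \<forall>j\<in>V. \<not> R i j"
      have "y j < y i" if "i \<in> V" "j \<in> V" "E i 0 < E j 0" for i j
      proof -
        have "i \<noteq> j" "i \<in> J" "j \<in> J" using that V(1) UJ by auto
        then have "y i \<noteq> y j" using disj[of i j "Suc k" "Suc k"] by (simp add: y_def)
        moreover have "\<not> R i j" using V(3) that by blast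
        ultimately show ?thesis using that(3) by (simp add: R_def)
      qed
      then have "clique_on ((1, False) # bs) E V"
        using V(1) ext[where t = False] unfolding clique_on_def by (meson subsetD)
      moreover have "V \<subseteq> J" using V(1) anti(1) T(1) by simp
      ultimately show ?thesis using V(2) by (intro exI[of _ V]) simp
    qed
  qed
qed

section \<open>The induction on the edge size\<close>

lemma large_clique_on:
  fixes E :: "'a \<Rightarrow> nat \<Rightarrow> nat" and x :: "(nat \<times> bool) list \<Rightarrow> real"
  assumes "finite I"
    and "\<And>i. i \<in> I \<Longrightarrow> strict_mono_on {..k} (E i)"
    and "\<And>i i' j j'. \<lbrakk>i \<in> I; i' \<in> I; i \<noteq> i'; j \<le> k; j' \<le> k\<rbrakk> \<Longrightarrow> E i j \<noteq> E i' j'"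
    and "\<And>bs. bs \<in> block_lists k \<Longrightarrow> x bs > 0"
    and "real (card I) > prod x (block_lists k)"
  shows "\<exists>bs\<in>block_lists k. \<exists>J\<subseteq>I. clique_on bs E J \<and> real (card J) > x bs / 2 ^ (fst (hd bs) - 2)"
  using assms
proof (induction k arbitrary: x)
  case 0
  have "clique_on [(1, True)] E I" by (simp add: clique_on_def)
  moreover have "real (card I) > x [(1, True)]" using 0 by simp
  ultimately have "clique_on [(1, True)] E I \<and>
      real (card I) > x [(1, True)] / 2 ^ (fst (hd [(1 :: nat, True)]) - 2)" by simp
  then show ?case unfolding block_lists.simps by blast
next
  case (Suc k)
  \<comment> \<open>The threshold of a parent is the product of those of its three children, so the
    total product is unchanged.\<close>
  let ?z = "\<lambda>bs. x (extend_last bs) * (x ((1, True) # bs) * x ((1, False) # bs))"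
  have xpos: "x (extend_last bs) > 0" "x ((1, True) # bs) > 0" "x ((1, False) # bs) > 0"
    if "bs \<in> block_lists k" for bs using Suc.prems(4) that by auto
  have "\<exists>bs\<in>block_lists k. \<exists>J\<subseteq>I. clique_on bs E J \<and> real (card J) > ?z bs / 2 ^ (fst (hd bs) - 2)"
  proof (rule Suc.IH)
    show "strict_mono_on {..k} (E i)" if "i \<in> I" for i
      using Suc.prems(2)[OF that] by (rule monotone_on_subset) auto
    show "real (card I) > prod ?z (block_lists k)"
      using Suc.prems(5) by (simp only: prod_block_lists_Suc)
  qed (use Suc.prems(1,3) xpos in auto)
  then obtain bs J where J: "bs \<in> block_lists k" "J \<subseteq> I" "clique_on bs E J"
    "real (card J) > ?z bs / 2 ^ (fst (hd bs) - 2)" by blast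
  obtain c s ds where bs: "bs = (c, s) # ds" "c \<ge> 1" using block_lists_Cons[OF J(1)] by metis
  \<comment> \<open>The whole denominator, including a new halving, is charged to the extended word.
    The other two words end in a block of size 1, whose exponent is 0.\<close>
  have "\<exists>J'\<subseteq>J. (clique_on (extend_last bs) E J' \<and> real (card J') > x (extend_last bs) / 2 ^ (c - 1)) \<or>
    (clique_on ((1, True) # bs) E J' \<and> real (card J') > x ((1, True) # bs)) \<or>
    (clique_on ((1, False) # bs) E J' \<and> real (card J') > x ((1, False) # bs))"
  proof (rule extend_clique[OF J(1) bs(1) _ _ _ J(3)])
    show "finite J" using J(2) Suc.prems(1) finite_subset by blast
    \<comment> \<open>For \<open>c = 1\<close> truncated subtraction makes both exponents 0, in
      agreement with the absence of a halving.\<close>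
    have "(2::real) ^ (c - 1) = 2 ^ (c - 2) * (if c \<ge> 2 then 2 else 1)"
    proof (cases "c \<ge> 2")
      case True
      then have "c - 1 = Suc (c - 2)" by simp
      then show ?thesis using True by simp
    qed (use bs(2) in auto)
    then show "real (card J) > x (extend_last bs) / 2 ^ (c - 1) *
        (x ((1, True) # bs) * x ((1, False) # bs)) * (if c \<ge> 2 then 2 else 1)"
      using J(4) bs(1) by (simp add: field_simps split: if_splits)
    show "E i j \<noteq> E i' j'" if "i \<in> J" "i' \<in> J" "i \<noteq> i'" "j \<le> Suc k" "j' \<le> Suc k" for i i' j j'
      using Suc.prems(3)[of i i' j j'] that J(2) by blast
  qed (use Suc.prems(2) J(2) xpos[OF J(1)] in auto)
  then obtain J' where J': "J' \<subseteq> I"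
    and alt: "(clique_on (extend_last bs) E J' \<and> real (card J') > x (extend_last bs) / 2 ^ (c - 1)) \<or>
    (clique_on ((1, True) # bs) E J' \<and> real (card J') > x ((1, True) # bs)) \<or>
    (clique_on ((1, False) # bs) E J' \<and> real (card J') > x ((1, False) # bs))"
    using J(2) by (meson order_trans)
  define good where "good cs \<longleftrightarrow> clique_on cs E J' \<and> real (card J') > x cs / 2 ^ (fst (hd cs) - 2)" for cs
  have "fst (hd (extend_last bs)) - 2 = c - 1" using bs by simp
  then have "good (extend_last bs) \<or> good ((1, True) # bs) \<or> good ((1, False) # bs)"
    using alt by (simp add: good_def)
  moreover have "extend_last bs \<in> block_lists (Suc k)" "(1, True) # bs \<in> block_lists (Suc k)"
    "(1, False) # bs \<in> block_lists (Suc k)" using J(1) by auto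
  ultimately have "\<exists>cs\<in>block_lists (Suc k). good cs" by blast
  then show ?case using J' unfolding good_def by blast
qed

section \<open>All collectable patterns, and the bound\<close>

theorem theorem2p5:
  fixes r n :: nat and P :: "nat \<Rightarrow> letter list" and x :: "nat \<Rightarrow> real"
    and M :: "nat set set"
  assumes "r \<ge> 2"
    and "bij_betw P {1..3 ^ (r - 1)} {w. collectable r w}"
    and "\<And>i. i \<in> {1..3 ^ (r - 1)} \<Longrightarrow> x i > 0"
    and "real n > (\<Prod>i = 1..3 ^ (r - 1). x i)"
    and "ordered_matching r n M"
  shows "\<exists>i\<in>{1..3 ^ (r - 1)}. \<exists>Q\<subseteq>M.
           pattern_clique r (P i) Q \<and> real (card Q) > x i * 2 powr (- real (maturity (P i)))"
proof -
  define k where "k = r - 1"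
  have r: "r = Suc k" using assms(1) by (simp add: k_def)
  let ?N = "{1..3 ^ k :: nat}"
  note bij = assms(2)[unfolded k_def[symmetric]]
  have "card {w. collectable r w} = 3 ^ k" using bij_betw_same_card[OF bij] by simp
  moreover have "finite {w. collectable r w}" using bij_betw_finite[OF bij] by simp
  moreover have "card (blocks_word ` block_lists k) = 3 ^ k"
    by (simp add: card_image inj_on_blocks_word card_block_lists)
  \<comment> \<open>The block words are collectable and as numerous as the finite set of all
    collectable patterns, so they exhaust it.\<close>
  ultimately have all: "blocks_word ` block_lists k = {w. collectable r w}"
    using collectable_blocks_word by (intro card_subset_eq) (auto simp: r)
  \<comment> \<open>Transports the thresholds from the given numbering of patterns to block lists,
    preserving their product.\<close>
  define idx where "idx bs = inv_into ?N P (blocks_word bs)" for bs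
  have idx: "bij_betw idx (block_lists k) ?N"
    unfolding idx_def
    using bij_betw_trans[OF bij_betw_imageI[OF inj_on_blocks_word all] bij_betw_inv_into[OF bij]]
    by (simp add: o_def)
  have P_idx: "P (idx bs) = blocks_word bs" if "bs \<in> block_lists k" for bs
    unfolding idx_def using that all bij by (intro f_inv_into_f) (auto simp: bij_betw_def)
  have idx_in: "idx bs \<in> ?N" if "bs \<in> block_lists k" for bs
    using idx that by (auto simp: bij_betw_def)
  have M: "finite M" "\<And>e. e \<in> M \<Longrightarrow> finite e \<and> card e = Suc k" "pairwise disjnt M" "card M = n"
    using assms(5) by (auto simp: ordered_matching_def edge_matching_def r)
  define E where "E e j = sorted_list_of_set e ! j" for e :: "nat set" and j
  have E_img: "E e ` {..k} = e" if "e \<in> M" for e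
    using nth_image[of "Suc k" "sorted_list_of_set e"] M(2)[OF that]
    by (simp add: E_def atLeast0LessThan lessThan_Suc_atMost)
  have E_mono: "strict_mono_on {..k} (E e)" if "e \<in> M" for e
    using M(2)[OF that] sorted_wrt_nth_less[OF strict_sorted_list_of_set[of e]]
    by (intro strict_mono_onI) (auto simp: E_def)
  have E_disj: "E e ` {..k} \<inter> E f ` {..k} = {}" if "e \<in> M" "f \<in> M" "e \<noteq> f" for e f
    using M(3) that by (simp add: E_img pairwise_def disjnt_def)
  have "\<exists>bs\<in>block_lists k. \<exists>Q\<subseteq>M. clique_on bs E Q \<and>
      real (card Q) > x (idx bs) / 2 ^ (fst (hd bs) - 2)"
  proof (rule large_clique_on)
    show "E e j \<noteq> E f j'" if "e \<in> M" "f \<in> M" "e \<noteq> f" "j \<le> k" "j' \<le> k" for e f j j'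
      using E_disj[OF that(1-3)] that(4,5) by blast
    show "x (idx bs) > 0" if "bs \<in> block_lists k" for bs
      using assms(3) idx_in[OF that] by (simp add: k_def)
    show "real (card M) > (\<Prod>bs\<in>block_lists k. x (idx bs))"
      using assms(4) prod.reindex_bij_betw[OF idx, of x] M(4) by (simp add: k_def)
  qed (use M(1) E_mono in auto)
  then obtain bs Q where Q: "bs \<in> block_lists k" "Q \<subseteq> M" "clique_on bs E Q"
    "real (card Q) > x (idx bs) / 2 ^ (fst (hd bs) - 2)" by blast
  have mat: "maturity (blocks_word bs) = fst (hd bs) - 2"
    using block_lists_Cons[OF Q(1)] maturity_blocks_word by (metis fst_conv list.sel(1))
  have "forms_pattern e f (blocks_word bs)" if "e \<in> Q" "f \<in> Q" "e \<noteq> f" for e f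
    using clique_on_forms_pattern[OF Q(1,3), of e f] E_mono E_disj[of e f] E_img that Q(2)
    by (simp add: subset_iff)
  moreover have "edge_matching r Q"
    using M Q(2) finite_subset[OF Q(2)] pairwise_subset[of disjnt M Q]
    by (auto simp: edge_matching_def r)
  ultimately have "pattern_clique r (P (idx bs)) Q"
    by (simp add: pattern_clique_def P_idx[OF Q(1)])
  moreover have "real (card Q) > x (idx bs) * 2 powr (- real (maturity (P (idx bs))))"
    using Q(4) by (simp add: P_idx[OF Q(1)] mat powr_minus powr_realpow divide_inverse)
  ultimately show ?thesis using idx_in[OF Q(1)] Q(2) unfolding k_def by blast
qed

end
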